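(* Let $R$ be a commutative ring with a multiplicative identity. If every subgroup of $(R,+)$ is also an ideal of $R$, then $R$ is isomorphic (as a ring) to either $\mathbb{Z}$ or $\mathbb{Z}_n$ for some positive integer $n$.
   Context: $\mathbb{Z}_n$ is the ring of integers modulo $n$. *)

theory Defs
  imports "HOL-Algebra.Algebra"
begin

end

theory Submission
  imports Defs
begin

text \<open>
  Consider the additive subgroup generated by the identity, which consists of the integer
  multiples of \<open>\<one>\<close>. By hypothesis it is an ideal. It contains \<open>\<one>\<close>, and an ideal that
  contains \<open>\<one>\<close> is the whole ring, so every element of the ring is an integer multiple of \<open>\<one>\<close>.
  Hence the canonical ring homomorphism \<open>k \<mapsto> add_pow R k \<one>\<close> from the integers is surjective
  (\<open>range_int_multiples_of_one\<close>). Its kernel is the ideal generated by the additive order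
  \<open>n\<close> of \<open>\<one>\<close>, where \<open>n = 0\<close> stands for infinite order
  (\<open>kernel_int_multiples_of_one\<close>). By the first isomorphism theorem the ring is
  \<open>\<int>\<close> modulo this ideal, which is \<open>\<int>\<close> itself if \<open>n = 0\<close>.
\<close>

lemma (in ring) int_multiples_of_one_ring_hom:
  "ring_hom_ring int_ring R (\<lambda>k::int. add_pow R k \<one>)"
proof (rule ring_hom_ringI)
  show "ring int_ring"
    by (rule cring.axioms(1)[OF int_is_cring])
  show "ring R"
    by (rule ring_axioms)
  fix x y :: int
  have "add_pow R (x * y) \<one> = add_pow R x (add_pow R y \<one>)"
    by (simp add: add.int_pow_pow mult.commute)
  also have "\<dots> = add_pow R x \<one> \<otimes> add_pow R y \<one>"
    by (simp add: add_pow_ldistr_int)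
  finally show "add_pow R (x \<otimes>\<^bsub>int_ring\<^esub> y) \<one> = add_pow R x \<one> \<otimes> add_pow R y \<one>"
    by simp
qed (simp_all add: add.int_pow_mult)

text \<open>
  By convention an element of infinite order has order 0, so the equation also covers an
  injective homomorphism, whose kernel is the zero ideal.
\<close>
lemma (in ring) kernel_int_multiples_of_one:
  "a_kernel int_ring R (\<lambda>k::int. add_pow R k \<one>) = Idl\<^bsub>int_ring\<^esub> {int (add.ord \<one>)}"
  by (auto simp: a_kernel_def' int_Idl add.int_pow_eq_id dvd_def mult.commute)

lemma (in ring) range_int_multiples_of_one:
  assumes "\<And>H. additive_subgroup H R \<Longrightarrow> ideal H R"
  shows "range (\<lambda>k::int. add_pow R k \<one>) = carrier R"
proof -
  have generated: "generate (add_monoid R) {\<one>} = range (\<lambda>k::int. add_pow R k \<one>)"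
    using add.generate_pow[OF one_closed] by auto
  have "additive_subgroup (generate (add_monoid R) {\<one>}) R"
    by (simp add: additive_subgroupI add.generate_is_subgroup)
  then have "ideal (generate (add_monoid R) {\<one>}) R"
    by (rule assms)
  then have "generate (add_monoid R) {\<one>} = carrier R"
    by (rule ideal.one_imp_carrier) (simp add: generate.incl)
  then show ?thesis
    using generated by simp
qed

theorem proposition2p1:
  fixes R (structure)
  assumes "cring R"
    and "\<And>H. additive_subgroup H R \<Longrightarrow> ideal H R"
  shows "R \<simeq> int_ring \<or> (\<exists>n::nat. n > 0 \<and> R \<simeq> ZFact (int n))"
proof -
  interpret cring R by fact
  define n where "n = add.ord \<one>"
  have "ZFact (int n) \<simeq> R"
    using ring_hom_ring.FactRing_iso[OF int_multiples_of_one_ring_hom]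
      range_int_multiples_of_one[OF assms(2)]
    by (simp add: ZFact_def n_def kernel_int_multiples_of_one)
  then have iso: "R \<simeq> ZFact (int n)"
    by (rule ring_iso_sym[OF cring.axioms(1)[OF ZFact_is_cring]])
  show ?thesis
  proof (cases "n = 0")
    case True
    have "ZFact 0 \<simeq> int_ring"
      using int.FactRing_zeroideal(1) by (simp add: ZFact_def int.genideal_zero)
    with iso True have "R \<simeq> int_ring"
      by (auto intro: ring_iso_trans)
    then show ?thesis ..
  next
    case False
    with iso show ?thesis by blast
  qed
qed

end
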